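(* Assume the abc conjecture is true. Let $y=y(x)$ be a non-decreasing function from the positive real numbers to the real numbers with $y(x)\ge 3$ for all $x>0$. Let $n_1<n_2<n_3<\cdots$ be the increasing sequence of all positive integers $n$ with $P(n)\le y(n)$, and let $\varepsilon$ be a positive real number. Then there exist a positive number $c_1(\varepsilon)$, depending on $\varepsilon$, and a positive number $c_2$ such that for all $i\ge 1$, $$n_{i+1}-n_i > \frac{c_1(\varepsilon)\, n_i^{1-\varepsilon}}{\exp(c_2\, y(n_{i+1}))}.$$
   Context: For an integer $n$, $P(n)$ denotes the greatest prime factor of $n$, with the convention $P(0)=P(\pm1)=1$. The abc conjecture: for each real $\varepsilon>0$ there is a positive number $c(\varepsilon)$, depending only on $\varepsilon$, such that for all pairwise coprime positive integers $x,y,z$ with $x+y=z$ one has $z<c(\varepsilon)G^{1+\varepsilon}$, where $G=\prod_{p\mid xyz,\ p\text{ prime}}p$. *)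

theory Defs
  imports Complex_Main "HOL-Computational_Algebra.Primes" "HOL-Library.Infinite_Set"
begin

definition greatest_prime_factor :: "int \<Rightarrow> nat" where
  "greatest_prime_factor n =
     (if n = 0 \<or> \<bar>n\<bar> = 1 then 1 else Max {p :: nat. prime p \<and> int p dvd n})"

definition radical :: "nat \<Rightarrow> nat" where
  "radical n = (\<Prod>p | prime p \<and> p dvd n. p)"

definition abc_conjecture :: bool where
  "abc_conjecture \<longleftrightarrow>
     (\<forall>\<epsilon>::real. \<epsilon> > 0 \<longrightarrow> (\<exists>c::real. c > 0 \<and>
       (\<forall>x y z :: nat. x > 0 \<longrightarrow> y > 0 \<longrightarrow> z > 0 \<longrightarrow>
          coprime x y \<longrightarrow> coprime x z \<longrightarrow> coprime y z \<longrightarrow> x + y = z \<longrightarrow>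
          real z < c * real (radical (x * y * z)) powr (1 + \<epsilon>))))"

definition smooth_numbers :: "(real \<Rightarrow> real) \<Rightarrow> nat set" where
  "smooth_numbers y =
     {n. n > 0 \<and> real (greatest_prime_factor (int n)) \<le> y (real n)}"

text \<open>
  The sequence \<open>n\<^sub>1 < n\<^sub>2 < \<dots>\<close>, indexed from 1; the library function \<^const>\<open>enumerate\<close> counts
  from 0, and is meaningful here because the set is infinite, as shown below.
\<close>
definition smooth_seq :: "(real \<Rightarrow> real) \<Rightarrow> nat \<Rightarrow> nat" where
  "smooth_seq y i = enumerate (smooth_numbers y) (i - 1)"

lemma greatest_prime_factor_two_power: "greatest_prime_factor (int (2 ^ Suc k)) = 2"
proof -
  have "{p :: nat. prime p \<and> int p dvd int (2 ^ Suc k)} = {2}"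
  proof (intro equalityI subsetI)
    fix p :: nat
    assume "p \<in> {p. prime p \<and> int p dvd int (2 ^ Suc k)}"
    then have p: "prime p" "p dvd 2 ^ Suc k"
      by (simp_all only: mem_Collect_eq int_dvd_int_iff)
    then have "p dvd 2"
      using prime_dvd_power by blast
    with p show "p \<in> {2}"
      using primes_dvd_imp_eq two_is_prime_nat by blast
  next
    fix p :: nat
    assume "p \<in> {2}"
    then show "p \<in> {p. prime p \<and> int p dvd int (2 ^ Suc k)}"
      by simp
  qed
  moreover have "\<bar>int (2 ^ Suc k)\<bar> \<noteq> 1" "int (2 ^ Suc k) \<noteq> 0"
    by (simp_all add: zmult_eq_1_iff)
  ultimately show ?thesis
    unfolding greatest_prime_factor_def by simp
qed

lemma infinite_smooth_numbers:
  assumes "\<And>x. x > 0 \<Longrightarrow> y x \<ge> 3"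
  shows "infinite (smooth_numbers y)"
proof -
  have "(2::nat) ^ Suc k \<in> smooth_numbers y" for k
    using assms[of "real (2 ^ Suc k)"] greatest_prime_factor_two_power[of k]
    unfolding smooth_numbers_def by simp
  then have "range (\<lambda>k. (2::nat) ^ Suc k) \<subseteq> smooth_numbers y"
    by blast
  moreover have "inj (\<lambda>k. (2::nat) ^ Suc k)"
    by (rule injI) simp
  then have "infinite (range (\<lambda>k. (2::nat) ^ Suc k))"
    by (rule range_inj_infinite)
  ultimately show ?thesis
    using finite_subset by blast
qed

end

theory Submission
  imports Defs
begin

text \<open>
  Let \<open>n < m\<close> be consecutive terms, \<open>k = m - n\<close> and \<open>d = gcd n k\<close>. Apply the abc conjecture to
  \<open>n/d + k/d = m/d\<close>. The primes dividing \<open>n m\<close> are at most \<open>y(m)\<close>, so by Chebyshev's bound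
  the radical is at most \<open>4\<^bsup>y(m)\<^esup> k/d\<close>; solving the resulting inequality for \<open>k\<close>
  gives the claim with \<open>c\<^sub>2 = ln 4\<close>.
\<close>

section \<open>Chebyshev's bound for the product of the primes up to \<open>n\<close>\<close>

lemma prod_primes_dvd:
  fixes n :: nat
  assumes "finite A" and "\<And>p. p \<in> A \<Longrightarrow> prime p \<and> p dvd n"
  shows "\<Prod>A dvd n"
  using assms
proof (induction A rule: finite_induct)
  case (insert p A)
  have "coprime p q" if "q \<in> A" for q
    using that insert by (metis insertI1 insertI2 primes_coprime)
  then have "coprime p (\<Prod>A)"
    by (intro prod_coprime_right)
  then show ?case
    using insert by (simp add: divides_mult)
qed simp

text \<open>The two central coefficients of this row are equal, and the whole row sums to
  \<open>2 * 4 ^ m\<close>, so each is at most half of that.\<close>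

lemma middle_binomial_le: "(2 * m + 1) choose m \<le> 4 ^ m"
proof -
  have "((2 * m + 1) choose m) + ((2 * m + 1) choose (m + 1)) =
      (\<Sum>k\<in>{m, m + 1}. (2 * m + 1) choose k)"
    by simp
  also have "\<dots> \<le> (\<Sum>k\<le>2 * m + 1. (2 * m + 1) choose k)"
    by (intro sum_mono2) auto
  also have "\<dots> = 2 * 4 ^ m"
    by (subst choose_row_sum) (simp add: power_mult)
  also have "(2 * m + 1) choose (m + 1) = (2 * m + 1) choose m"
    by (subst binomial_symmetric) auto
  finally show ?thesis
    by simp
qed

text \<open>Erdos's induction. An even \<open>n\<close> above 2 is not prime, so
  \<open>n - 1\<close> has the same product. For \<open>n = 2 * m + 1\<close>, the primes above
  \<open>m + 1\<close> all divide a central binomial coefficient, which is at most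
  \<open>4 ^ m\<close>; the induction hypothesis at \<open>m + 1\<close> covers the others.\<close>

lemma primorial_le: "\<Prod>{p::nat. prime p \<and> p \<le> n} \<le> 4 ^ n"
proof (induction n rule: less_induct)
  case (less n)
  consider "n \<le> 2" | m where "n = 2 * m" "m \<ge> 2" | m where "n = 2 * m + 1" "m \<ge> 1"
    by (cases "even n") (auto elim!: evenE oddE, force+)
  then show ?case
  proof cases
    case 1
    have "p = 2" if "prime p" "p \<le> n" for p :: nat
      using that 1 prime_ge_2_nat[of p] by simp
    then have "{p::nat. prime p \<and> p \<le> n} = (if n = 2 then {2} else {})"
      using 1 by auto
    then show ?thesis
      by simp
  next
    case (2 m)
    have "p \<le> n \<longleftrightarrow> p \<le> n - 1" if "prime p" for p
    proof -
      have "p \<noteq> n"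
        using that 2 prime_nat_not_dvd[of p 2] by auto
      with 2 show ?thesis
        by linarith
    qed
    then have "{p. prime p \<and> p \<le> n} = {p. prime p \<and> p \<le> n - 1}"
      by blast
    moreover have "\<Prod>{p. prime p \<and> p \<le> n - 1} \<le> 4 ^ (n - 1)"
      using 2 by (intro less.IH) auto
    moreover have "(4::nat) ^ (n - 1) \<le> 4 ^ n"
      by (intro power_increasing) auto
    ultimately show ?thesis
      by (simp only: order_trans)
  next
    case (3 m)
    let ?A = "{p::nat. prime p \<and> p \<le> m + 1}" and ?B = "{p::nat. prime p \<and> m + 1 < p \<and> p \<le> n}"
    have fin: "finite ?A" "finite ?B"
      by simp_all
    have "{p. prime p \<and> p \<le> n} = ?A \<union> ?B"
      using 3 by auto
    then have "\<Prod>{p. prime p \<and> p \<le> n} = \<Prod>?A * \<Prod>?B"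
      using fin by (simp only:, subst prod.union_disjoint) auto
    also have "\<dots> \<le> 4 ^ (m + 1) * 4 ^ m"
    proof (intro mult_mono)
      show "\<Prod>?A \<le> 4 ^ (m + 1)"
        using 3 by (intro less.IH) auto
      have "\<Prod>?B dvd (2 * m + 1) choose m"
      proof (rule prod_primes_dvd[OF fin(2)])
        fix p
        assume "p \<in> ?B"
        then have p: "prime p" "m + 1 < p" "p \<le> n"
          by auto
        \<comment> \<open>Since \<open>m + 1 < p\<close> and \<open>p \<le> n\<close>, the prime
          \<open>p\<close> divides \<open>fact n\<close> but neither factorial on the left, so it
          must divide the binomial coefficient.\<close>
        have "fact m * fact (m + 1) * ((2 * m + 1) choose m) = (fact n :: nat)"
          using binomial_fact_lemma[of m "2 * m + 1"] 3 by (simp add: Suc_diff_le)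
        then have "p dvd fact m * fact (m + 1) * ((2 * m + 1) choose m)"
          using p by (simp add: prime_dvd_fact_iff)
        then show "prime p \<and> p dvd (2 * m + 1) choose m"
          using p by (auto simp only: prime_dvd_mult_iff prime_dvd_fact_iff)
      qed
      then have "\<Prod>?B \<le> (2 * m + 1) choose m"
        by (intro dvd_imp_le) auto
      then show "\<Prod>?B \<le> 4 ^ m"
        using middle_binomial_le[of m] by linarith
    qed auto
    also have "\<dots> = 4 ^ n"
      using 3 by (simp add: power_add[symmetric] mult_2)
    finally show ?thesis .
  qed
qed

section \<open>Bounds for radicals\<close>

lemma finite_prime_divisors_nat: "n > 0 \<Longrightarrow> finite {p::nat. prime p \<and> p dvd n}"
  by (rule finite_subset[of _ "{..n}"]) (auto dest: dvd_imp_le)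

lemma radical_le: "n > 0 \<Longrightarrow> radical n \<le> n"
  unfolding radical_def
  by (intro dvd_imp_le prod_primes_dvd finite_prime_divisors_nat) auto

text \<open>The primes of \<open>a\<close> are absorbed into the primorial of \<open>N\<close>,
  while those of \<open>b\<close>, which may be large, contribute at most \<open>b\<close>. In the
  application \<open>a\<close> is smooth and \<open>b\<close> comes from the gap.\<close>

lemma radical_mult_le:
  assumes "b > 0" and "\<And>p. prime p \<Longrightarrow> p dvd a \<Longrightarrow> p \<le> N"
  shows "radical (a * b) \<le> 4 ^ N * b"
proof -
  let ?A = "{p::nat. prime p \<and> p \<le> N}" and ?B = "{p::nat. prime p \<and> p dvd b}"
  have fin: "finite ?A" "finite ?B"
    using assms(1) by (auto intro: finite_prime_divisors_nat)
  have "radical (a * b) \<le> \<Prod>(?A \<union> ?B)"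
    unfolding radical_def using fin assms
    by (intro dvd_imp_le prod_dvd_prod_subset prod_pos)
      (auto simp: prime_dvd_mult_iff dest: prime_gt_0_nat)
  \<comment> \<open>The extra factor is at least 1; it lets the product split over \<open>?A\<close>
    and \<open>?B\<close> although they may overlap.\<close>
  also have "\<dots> \<le> \<Prod>(?A \<union> ?B) * \<Prod>(?A \<inter> ?B)"
    by (auto intro!: prod_pos dest: prime_gt_0_nat simp: Suc_le_eq)
  also have "\<dots> = \<Prod>?A * radical b"
    using fin by (simp add: prod.union_inter radical_def)
  also have "\<dots> \<le> 4 ^ N * b"
    using assms(1) by (intro mult_mono primorial_le radical_le) auto
  finally show ?thesis .
qed

section \<open>From abc to gaps between smooth numbers\<close>

lemma prime_divisor_le_greatest_prime_factor:
  assumes "prime p" "p dvd n" "n > 0"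
  shows "p \<le> greatest_prime_factor (int n)"
proof -
  have "n \<noteq> 1"
    using assms by auto
  moreover have "p \<le> Max {p. prime p \<and> p dvd n}"
    using assms by (intro Max_ge finite_prime_divisors_nat) auto
  ultimately show ?thesis
    using assms by (simp add: greatest_prime_factor_def)
qed

text \<open>The exponent and its abc constant \<open>c\<close> are fixed, and \<open>Y\<close>
  stands for \<open>y(m)\<close>. The resulting constant depends only on \<open>c\<close> and
  \<open>\<epsilon>\<close>, not on \<open>Y\<close>, \<open>n\<close> or \<open>m\<close>.\<close>

lemma abc_smooth_gap:
  fixes n m :: nat and c \<epsilon> Y :: real
  assumes abc: "\<And>x y z :: nat. \<lbrakk>x > 0; y > 0; z > 0; coprime x y; coprime x z; coprime y z;
      x + y = z\<rbrakk> \<Longrightarrow> real z < c * real (radical (x * y * z)) powr (1 + \<epsilon>)"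
    and c: "c > 0" and \<epsilon>: "\<epsilon> > 0" and nm: "0 < n" "n < m"
    and primes: "\<And>p. prime p \<Longrightarrow> p dvd n * m \<Longrightarrow> real p \<le> Y" and Y: "Y \<ge> 0"
  shows "c powr (- 1 / (1 + \<epsilon>)) * real n powr (1 - \<epsilon>) / exp (ln 4 * Y) < real m - real n"
proof -
  define k where "k = m - n"
  define d where "d = gcd n k"
  have k: "k > 0" "m = n + k"
    using nm by (auto simp: k_def)
  have d: "d > 0"
    using nm by (simp add: d_def)
  then obtain x z where xz: "n = d * x" "k = d * z" "coprime x z"
    using gcd_coprime_exists[of n k] unfolding d_def by (metis mult.commute neq0_conv)
  then have pos: "x > 0" "z > 0"
    using nm k by auto
  have "coprime x (x + z)" "coprime z (x + z)"
    using xz(3) by (metis coprime_iff_gcd_eq_1 gcd.commute gcd_add2 add.commute)+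
  then have "real (x + z) < c * real (radical (x * z * (x + z))) powr (1 + \<epsilon>)"
    using pos xz(3) by (intro abc) auto
  moreover have "real (radical (x * z * (x + z))) \<le> 4 powr Y * real z"
  proof -
    have "p \<le> nat \<lfloor>Y\<rfloor>" if "prime p" "p dvd x * (x + z)" for p
    proof -
      \<comment> \<open>Here \<open>x = n/d\<close> and \<open>x + z = m/d\<close>, so both inherit
        smoothness; only \<open>z\<close> may have large prime factors.\<close>
      have "x * (x + z) dvd n * m"
        unfolding k xz by (metis dvd_triv_right distrib_left mult_dvd_mono)
      then have "real p \<le> Y"
        using that primes dvd_trans by blast
      then show ?thesis
        by (simp add: le_nat_floor)
    qed
    then have "radical (x * (x + z) * z) \<le> 4 ^ nat \<lfloor>Y\<rfloor> * z"
      using pos by (intro radical_mult_le) auto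
    then have "real (radical (x * z * (x + z))) \<le> real (4 ^ nat \<lfloor>Y\<rfloor> * z)"
      by (simp only: ac_simps of_nat_le_iff)
    also have "\<dots> = 4 powr real (nat \<lfloor>Y\<rfloor>) * real z"
      by (simp add: powr_realpow)
    also have "\<dots> \<le> 4 powr Y * real z"
      using Y by (intro mult_right_mono powr_mono) auto
    finally show ?thesis .
  qed
  then have "real (radical (x * z * (x + z))) powr (1 + \<epsilon>) \<le> (4 powr Y * real z) powr (1 + \<epsilon>)"
    using \<epsilon> by (intro powr_mono2) auto
  ultimately have "real (x + z) < c * (4 powr Y * real z) powr (1 + \<epsilon>)"
    using c by (auto intro: less_le_trans mult_left_mono)
  then have "real d * real (x + z) < real d * (c * (4 powr Y * real z) powr (1 + \<epsilon>))"
    using d by simp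
  moreover have "real n \<le> real d * real (x + z)"
    by (simp add: xz algebra_simps)
  \<comment> \<open>Raising \<open>d\<close> to the power \<open>1 + \<epsilon>\<close> moves it
    inside the power, where \<open>d * z\<close> becomes \<open>k\<close>.\<close>
  moreover have "real d \<le> real d powr (1 + \<epsilon>)"
    using d \<epsilon> powr_mono[of 1 "1 + \<epsilon>" "real d"] by simp
  then have "real d * (c * (4 powr Y * real z) powr (1 + \<epsilon>)) \<le>
      real d powr (1 + \<epsilon>) * (c * (4 powr Y * real z) powr (1 + \<epsilon>))"
    using c by (intro mult_right_mono) auto
  moreover have "\<dots> = c * (4 powr Y * real k) powr (1 + \<epsilon>)"
    by (simp add: xz powr_mult)
  ultimately have "real n < c * (4 powr Y * real k) powr (1 + \<epsilon>)"
    by linarith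
  then have "real n powr (1 / (1 + \<epsilon>)) < (c * (4 powr Y * real k) powr (1 + \<epsilon>)) powr (1 / (1 + \<epsilon>))"
    using \<epsilon> by (intro powr_less_mono2) auto
  also have "\<dots> = c powr (1 / (1 + \<epsilon>)) * (4 powr Y * real k)"
    using c \<epsilon> k by (simp add: powr_mult powr_powr)
  finally have upper: "real n powr (1 / (1 + \<epsilon>)) < c powr (1 / (1 + \<epsilon>)) * (4 powr Y * real k)" .
  \<comment> \<open>This amounts to \<open>(1 - \<epsilon>) * (1 + \<epsilon>) \<le> 1\<close>. As
    \<open>n\<close> is at least 1, the exponent can be lowered.\<close>
  have "1 - \<epsilon> \<le> 1 / (1 + \<epsilon>)"
    using \<epsilon> by (simp add: field_simps)
  then have "real n powr (1 - \<epsilon>) \<le> real n powr (1 / (1 + \<epsilon>))"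
    using nm by (intro powr_mono) auto
  with upper have "real n powr (1 - \<epsilon>) < c powr (1 / (1 + \<epsilon>)) * (4 powr Y * real k)"
    by linarith
  moreover have "4 powr Y = exp (ln 4 * Y)"
    by (simp add: powr_def mult.commute)
  moreover have "c powr (1 / (1 + \<epsilon>)) > 0"
    using c by simp
  ultimately have "real n powr (1 - \<epsilon>) / c powr (1 / (1 + \<epsilon>)) / exp (ln 4 * Y) < real k"
    by (simp add: pos_divide_less_eq mult_ac)
  then show ?thesis
    using k by (simp add: powr_minus_divide)
qed

theorem theorem2:
  assumes abc: "abc_conjecture"
  shows "\<exists>c\<^sub>2::real. c\<^sub>2 > 0 \<and>
    (\<forall>\<epsilon>::real. \<epsilon> > 0 \<longrightarrow> (\<exists>c\<^sub>1::real. c\<^sub>1 > 0 \<and>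
      (\<forall>y :: real \<Rightarrow> real. mono_on {0<..} y \<longrightarrow> (\<forall>x>0. y x \<ge> 3) \<longrightarrow>
        (\<forall>i\<ge>1. real (smooth_seq y (i + 1)) - real (smooth_seq y i)
           > c\<^sub>1 * real (smooth_seq y i) powr (1 - \<epsilon>)
               / exp (c\<^sub>2 * y (real (smooth_seq y (i + 1))))))))"
\<comment> \<open>The value \<open>ln 4\<close> turns \<open>4 powr Y\<close> into an exponential.
  It is fixed before \<open>\<epsilon>\<close>, and \<open>c\<^sub>1\<close> is fixed before
  \<open>y\<close>, so \<open>c\<^sub>2\<close> is absolute and \<open>c\<^sub>1\<close> depends on
  \<open>\<epsilon>\<close> alone.\<close>
proof (rule exI[of _ "ln 4 :: real"], intro conjI allI impI)
  fix \<epsilon> :: real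
  assume \<epsilon>: "\<epsilon> > 0"
  then obtain c :: real where c: "c > 0"
    and bound: "\<And>x y z :: nat. \<lbrakk>x > 0; y > 0; z > 0; coprime x y; coprime x z; coprime y z;
      x + y = z\<rbrakk> \<Longrightarrow> real z < c * real (radical (x * y * z)) powr (1 + \<epsilon>)"
    using abc unfolding abc_conjecture_def by metis
  show "\<exists>c\<^sub>1::real. c\<^sub>1 > 0 \<and>
      (\<forall>y :: real \<Rightarrow> real. mono_on {0<..} y \<longrightarrow> (\<forall>x>0. y x \<ge> 3) \<longrightarrow>
        (\<forall>i\<ge>1. real (smooth_seq y (i + 1)) - real (smooth_seq y i)
           > c\<^sub>1 * real (smooth_seq y i) powr (1 - \<epsilon>)
               / exp (ln 4 * y (real (smooth_seq y (i + 1))))))"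
  proof (intro exI[of _ "c powr (- 1 / (1 + \<epsilon>))"] conjI allI impI)
    fix y :: "real \<Rightarrow> real" and i :: nat
    assume mono: "mono_on {0<..} y" and ge3: "\<forall>x>0. y x \<ge> 3" and i: "1 \<le> i"
    define n where "n = smooth_seq y i"
    define m where "m = smooth_seq y (i + 1)"
    have inf: "infinite (smooth_numbers y)"
      using ge3 by (intro infinite_smooth_numbers) auto
    have mem: "n \<in> smooth_numbers y" "m \<in> smooth_numbers y"
      unfolding n_def m_def smooth_seq_def by (rule enumerate_in_set[OF inf])+
    then have pos: "n > 0" "m > 0"
      by (auto simp: smooth_numbers_def)
    \<comment> \<open>Because \<open>i\<close> is at least 1, \<open>Suc (i - 1) = i\<close>, so
      \<open>n\<close> and \<open>m\<close> are adjacent in the enumeration from 0.\<close>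
    have less: "n < m"
      using i enumerate_step[OF inf, of "i - 1"] by (simp add: n_def m_def smooth_seq_def)
    have "real p \<le> y (real m)" if "prime p" "p dvd n * m" for p
    proof -
      \<comment> \<open>Monotonicity gives the primes of \<open>n\<close> the same bound as those of
        \<open>m\<close>.\<close>
      have "y (real n) \<le> y (real m)"
        using mono pos less by (auto simp: mono_on_def)
      moreover have "p dvd n \<or> p dvd m"
        using that by (simp add: prime_dvd_mult_iff)
      moreover have "real p \<le> y (real q)" if "q \<in> {n, m}" "p dvd q" for q
      proof -
        have "real (greatest_prime_factor (int q)) \<le> y (real q)" "q > 0"
          using that mem by (auto simp: smooth_numbers_def)
        then show ?thesis
          using prime_divisor_le_greatest_prime_factor[OF \<open>prime p\<close> \<open>p dvd q\<close>] by linarith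
      qed
      ultimately show ?thesis
        by fastforce
    qed
    moreover have "y (real m) \<ge> 0"
      using ge3 pos by (smt (verit) of_nat_0_less_iff)
    ultimately show "c powr (- 1 / (1 + \<epsilon>)) * real (smooth_seq y i) powr (1 - \<epsilon>)
        / exp (ln 4 * y (real (smooth_seq y (i + 1))))
        < real (smooth_seq y (i + 1)) - real (smooth_seq y i)"
      unfolding n_def[symmetric] m_def[symmetric]
      by (intro abc_smooth_gap[OF bound c \<epsilon> pos(1) less])
  qed (use c in auto)
qed auto

end
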